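(* The ES (Edge Scanning) algorithm for dedicated routes, which computes the overall set of endpoints $EP$, creates at most $4he$ endpoints, where $h=|H|$ and $e=|E|$; that is, $|EP|\le 4he$.
   Context: **Network.** $G(V,E)$ is a finite simple connected undirected graph with $|V|=n$, $|E|=e$ and positive edge lengths. Each edge is regarded as a closed segment of that length joining its two vertices; a *point* of the network is a vertex or a location along an edge. For points $x_1,x_2$, $l(x_1,x_2)$ is the length of a shortest path $P(x_1,x_2)$ between them (symmetric). Triangle inequality assumption: the shortest path between two points of the same edge runs inside that edge; in particular $l(v_a,v_b)$ is the length of edge $(v_a,v_b)$. $C(v_a,v_b)$ is the closed segment formed by edge $(v_a,v_b)$. $R>0$ is the driving range and $D\ge 0$ the maximum allowed deviation distance. **Routes.** $H=\{U_1,\dots,U_h\}$, $h\ge 1$, is the set of routes to be covered. Each $U\in H$ is a directed closed walk consisting of a finite nonempty sequence of edges (edges may repeat, in either direction), with total length $l(U)\le R$ and flow $f(U)>0$; it carries a finite nonempty cyclic sequence $S_U$ of stops, each a position on the walk. We write $(v_a,v_b)\in U$ if the edge is traversed by $U$ in some direction. $U(y,z)$ is the part of $U$ from position $y$ to position $z$ in the travel direction, $l(U(y,z))$ its length, and $V(U(y,z))$ the set of vertices on it. For a stop $s$: $s^f_U(s)$ is the next stop after $s$; $v^a_U(s)$ is the vertex coinciding with or immediately after $s$ on $U$; $v^b_U(s)$ is the vertex coinciding with or immediately before $s$ on $U$. **Last stop and deviation vertex.** For a point $x$, $s^l_U(x)$ is a stop $s\in S_U$ minimizing $$l(s,v^a_U(s))+l(v^a_U(s),x)+l(x,v^b_U(s^f_U(s)))+l(v^b_U(s^f_U(s)),s^f_U(s))+l(U(s^f_U(s),s)),$$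 ties broken arbitrarily. Write $\bar v_U(x)=v^b_U(s^f_U(s^l_U(x)))$. The deviation vertex $v^d_U(x)$ is the vertex at which the path $P(v^a_U(s^l_U(x)),x)$ leaves the vertex set of the sub-route $U(v^a_U(s^l_U(x)),\bar v_U(x))$, i.e. the last vertex of the maximal initial run of vertices of that path lying in this set. Put $l'(U(\bar v_U(x),v^d_U(x)))=l(U)$ if $\bar v_U(x)=v^d_U(x)$, and $=l(U(\bar v_U(x),v^d_U(x)))$ otherwise. **Refueling sets.** Let $U\in H$ and $(v_a,v_b)\in E$. If $(v_a,v_b)\in U$, then $RS(U;v_a,v_b)=C(v_a,v_b)$. If $(v_a,v_b)\notin U$, then for $q\in\{a,b\}$ and $w\in\{a,b\}$, $w\ne q$, define $$\beta^{(q)}=\begin{cases} l(v_a,v_b), & \text{if } R-\big(l(v^d_U(v_q),v_q)+l(v_w,\bar v_U(v_q))+l'(U(\bar v_U(v_q),v^d_U(v_q)))\big)\ge l(v_a,v_b),\\ \tfrac12\Big(R-\big(l(v^d_U(v_q),v_q)+l(v_q,\bar v_U(v_q))+l'(U(\bar v_U(v_q),v^d_U(v_q)))\big)\Big), & \text{otherwise,}\end{cases}$$ $$\delta^{(q)}=\min\{D-l(v^d_U(v_q),v_q),\ \beta^{(q)}\},\qquad RS^{(q)}(U;v_a,v_b)=\{x\in C(v_a,v_b): l(v_q,x)\le\delta^{(q)}\},$$ and $RS(U;v_a,v_b)=RS^{(a)}(U;v_a,v_b)\cup RS^{(b)}(U;v_a,v_b)$. **Endpoints.** $EP(U;v_a,v_b)$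 is the set of endpoints of the closed segments (connected components, possibly single points) making up $RS(U;v_a,v_b)$; $EP(v_a,v_b)=\bigcup_{U\in H}EP(U;v_a,v_b)$ and $EP=\bigcup_{(v_a,v_b)\in E}EP(v_a,v_b)$. The ES algorithm computes, for every route $U\in H$ and every edge, the refueling set $RS(U;v_a,v_b)$ and its endpoints $EP(U;v_a,v_b)$, and outputs $EP$. *)

theory Defs
  imports "HOL-Analysis.Analysis"
begin

section \<open>Networks and their points\<close>

text \<open>
  Points are given by barycentric coordinates: a vertex is the indicator function of itself, and
  the point at distance t from a on the edge {a, b} has weight 1 - t / len {a, b} at a and weight
  t / len {a, b} at b. A vertex is therefore one and the same point on all its edges, and the
  product topology on \<^typ>\<open>'v \<Rightarrow> real\<close> induces the usual topology on each edge segment.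
\<close>

type_synonym 'v point = "'v \<Rightarrow> real"

definition vpt :: "'v \<Rightarrow> 'v point" where
  "vpt a = (\<lambda>v. if v = a then 1 else 0)"

locale network =
  fixes V :: "'v set"
    and E :: "'v set set"
    and len :: "'v set \<Rightarrow> real"
  assumes finite_V: "finite V"
    and V_nonempty: "V \<noteq> {}"
    and simple: "\<And>e. e \<in> E \<Longrightarrow> \<exists>a\<in>V. \<exists>b\<in>V. a \<noteq> b \<and> e = {a, b}"
    and connected: "\<And>a b. a \<in> V \<Longrightarrow> b \<in> V \<Longrightarrow> (a, b) \<in> {(u, v). {u, v} \<in> E}\<^sup>*"
    and len_pos: "\<And>e. e \<in> E \<Longrightarrow> len e > 0"
begin

definition loc :: "'v \<Rightarrow> 'v \<Rightarrow> real \<Rightarrow> 'v point" where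
  "loc a b t = (\<lambda>v. if v = a then 1 - t / len {a, b} else if v = b then t / len {a, b} else 0)"

definition C :: "'v \<Rightarrow> 'v \<Rightarrow> 'v point set" where
  "C a b = loc a b ` {0..len {a, b}}"

definition points :: "'v point set" where
  "points = vpt ` V \<union> {x. \<exists>a b. {a, b} \<in> E \<and> x \<in> C a b}"

text \<open>
  A path is listed by its starting point, the vertices it passes in order, and its final point;
  it moves between consecutive points of the list inside a common edge.
\<close>

definition step :: "'v point \<Rightarrow> 'v point \<Rightarrow> bool" where
  "step p q \<longleftrightarrow> p \<noteq> q \<and> (\<exists>a b. {a, b} \<in> E \<and> p \<in> C a b \<and> q \<in> C a b)"

definition step_len :: "'v point \<Rightarrow> 'v point \<Rightarrow> real" where
  "step_len p q = (THE d. \<exists>a b s t. {a, b} \<in> E \<and> s \<in> {0..len {a, b}} \<and> t \<in> {0..len {a, b}} \<and>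
     p = loc a b s \<and> q = loc a b t \<and> d = \<bar>s - t\<bar>)"

definition is_path :: "'v point \<Rightarrow> 'v point \<Rightarrow> 'v point list \<Rightarrow> bool" where
  "is_path x y ps \<longleftrightarrow> ps \<noteq> [] \<and> hd ps = x \<and> last ps = y \<and> x \<in> points \<and> y \<in> points \<and>
     set (butlast (tl ps)) \<subseteq> vpt ` V \<and> successively step ps"

definition path_len :: "'v point list \<Rightarrow> real" where
  "path_len ps = sum_list (map2 step_len ps (tl ps))"

definition is_shortest_path :: "'v point \<Rightarrow> 'v point \<Rightarrow> 'v point list \<Rightarrow> bool" where
  "is_shortest_path x y ps \<longleftrightarrow>
     is_path x y ps \<and> (\<forall>qs. is_path x y qs \<longrightarrow> path_len ps \<le> path_len qs)"

text \<open>The description in \<^term>\<open>step_len\<close> is unambiguous.\<close>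

lemma step_len_loc:
  assumes e: "{a, b} \<in> E" and s: "s \<in> {0..len {a, b}}" and t: "t \<in> {0..len {a, b}}"
  shows "step_len (loc a b s) (loc a b t) = \<bar>s - t\<bar>"
  unfolding step_len_def
proof (rule the_equality)
  show "\<exists>a' b' s' t'. {a', b'} \<in> E \<and> s' \<in> {0..len {a', b'}} \<and> t' \<in> {0..len {a', b'}} \<and>
     loc a b s = loc a' b' s' \<and> loc a b t = loc a' b' t' \<and> \<bar>s - t\<bar> = \<bar>s' - t'\<bar>"
    using assms by blast
next
  fix d
  assume "\<exists>a' b' s' t'. {a', b'} \<in> E \<and> s' \<in> {0..len {a', b'}} \<and> t' \<in> {0..len {a', b'}} \<and>
     loc a b s = loc a' b' s' \<and> loc a b t = loc a' b' t' \<and> d = \<bar>s' - t'\<bar>"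
  then obtain c f s' t' where e': "{c, f} \<in> E"
    and ps: "loc a b s = loc c f s'" and pt: "loc a b t = loc c f t'" and d: "d = \<bar>s' - t'\<bar>"
    by blast
  have ab: "a \<noteq> b" and cf: "c \<noteq> f"
    using simple[OF e] simple[OF e'] by (auto simp: doubleton_eq_iff)
  define L where "L = len {a, b}"
  define M where "M = len {c, f}"
  have L: "L > 0" and M: "M > 0"
    unfolding L_def M_def using len_pos e e' by auto
  have diff: "loc a b s v - loc a b t v = loc c f s' v - loc c f t' v" for v
    by (simp add: ps pt)
  have val: "loc a b s v - loc a b t v =
      (if v = a then (t - s) / L else if v = b then (s - t) / L else 0)"
    "loc c f s' v - loc c f t' v =
      (if v = c then (t' - s') / M else if v = f then (s' - t') / M else 0)" for v
    by (auto simp: loc_def L_def M_def diff_divide_distrib)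
  have eq: "(if v = a then (t - s) / L else if v = b then (s - t) / L else 0) =
      (if v = c then (t' - s') / M else if v = f then (s' - t') / M else 0)" for v
    using diff[of v] val[of v] by simp
  show "d = \<bar>s - t\<bar>"
  proof (cases "s = t")
    case True
    then show ?thesis using eq[of c] d M by (auto split: if_splits)
  next
    case False
    have "a \<in> {c, f}" "b \<in> {c, f}"
      using eq[of a] eq[of b] False ab L by (auto split: if_splits)
    then have LM: "{a, b} = {c, f}" "L = M"
      using ab by (auto simp: L_def M_def insert_commute)
    have "a = c \<or> a = f" using LM by auto
    then have "t - s = t' - s' \<or> t - s = s' - t'"
      using eq[of a] LM(2) L cf by (auto split: if_splits)
    then show ?thesis using d by auto
  qed
qed

end

text \<open>
  P fixes one shortest path between any two points. Only the selected path between two points of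
  an edge is required to stay on that edge; detours of equal length are not excluded.
\<close>

locale metric_network = network V E len
  for V :: "'v set" and E :: "'v set set" and len :: "'v set \<Rightarrow> real" +
  fixes P :: "'v point \<Rightarrow> 'v point \<Rightarrow> 'v point list"
  assumes P_shortest: "\<And>x y. x \<in> points \<Longrightarrow> y \<in> points \<Longrightarrow> is_shortest_path x y (P x y)"
    and triangle: "\<And>a b x y. {a, b} \<in> E \<Longrightarrow> x \<in> C a b \<Longrightarrow> y \<in> C a b \<Longrightarrow> set (P x y) \<subseteq> C a b"
begin

definition l :: "'v point \<Rightarrow> 'v point \<Rightarrow> real" where
  "l x y = path_len (P x y)"

end

section \<open>Routes\<close>

text \<open>
  A closed walk is given by its cyclic list of vertices, the i-th edge leading from the i-th
  vertex to the next one (and from the last back to the first). A position on the walk is a pair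
  (i, t): the location at distance t from the start of the i-th edge, where t is strictly less
  than the length of that edge, so that the i-th visited vertex is the position (i, 0) only.
  Positions, unlike points, distinguish repeated visits of the walk to the same place.
\<close>

type_synonym pos = "nat \<times> real"

record 'v route =
  r_walk :: "'v list"
  r_stops :: "pos list"
  r_flow :: real

context metric_network
begin

definition rv :: "'v route \<Rightarrow> nat \<Rightarrow> 'v" where
  "rv U i = r_walk U ! (i mod length (r_walk U))"

definition redge :: "'v route \<Rightarrow> nat \<Rightarrow> 'v set" where
  "redge U i = {rv U i, rv U (Suc i)}"

definition traverses :: "'v route \<Rightarrow> 'v \<Rightarrow> 'v \<Rightarrow> bool" where
  "traverses U a b \<longleftrightarrow> (\<exists>i<length (r_walk U). redge U i = {a, b})"

definition route_len :: "'v route \<Rightarrow> real" where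
  "route_len U = (\<Sum>i<length (r_walk U). len (redge U i))"

definition is_pos :: "'v route \<Rightarrow> pos \<Rightarrow> bool" where
  "is_pos U y \<longleftrightarrow> fst y < length (r_walk U) \<and> 0 \<le> snd y \<and> snd y < len (redge U (fst y))"

definition pt :: "'v route \<Rightarrow> pos \<Rightarrow> 'v point" where
  "pt U y = loc (rv U (fst y)) (rv U (Suc (fst y))) (snd y)"

definition offset :: "'v route \<Rightarrow> pos \<Rightarrow> real" where
  "offset U y = (\<Sum>i<fst y. len (redge U i)) + snd y"

text \<open>
  \<open>arc U y z\<close> is the length of U(y,z). For y = z the part U(y,z) is the single position y, of
  length 0; where a full turn is meant, \<open>rest_len\<close> below says so.
\<close>

definition arc :: "'v route \<Rightarrow> pos \<Rightarrow> pos \<Rightarrow> real" where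
  "arc U y z = (if offset U y \<le> offset U z then offset U z - offset U y
                else route_len U - (offset U y - offset U z))"

definition arc_vertices :: "'v route \<Rightarrow> pos \<Rightarrow> pos \<Rightarrow> 'v set" where
  "arc_vertices U y z = {rv U m |m. m < length (r_walk U) \<and> arc U y (m, 0) \<le> arc U y z}"

text \<open>
  The cyclic sequence of stops is listed in travel order, beginning with the first stop at or
  after the initial vertex of the walk. Stops are referred to by their index in this list.
\<close>

definition is_route :: "real \<Rightarrow> 'v route \<Rightarrow> bool" where
  "is_route R U \<longleftrightarrow>
     r_walk U \<noteq> [] \<and> (\<forall>i<length (r_walk U). redge U i \<in> E) \<and>
     route_len U \<le> R \<and> r_flow U > 0 \<and>
     r_stops U \<noteq> [] \<and> (\<forall>y\<in>set (r_stops U). is_pos U y) \<and>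
     sorted_wrt (\<lambda>y z. offset U y < offset U z) (r_stops U)"

definition stop :: "'v route \<Rightarrow> nat \<Rightarrow> pos" where
  "stop U j = r_stops U ! j"

definition next_stop :: "'v route \<Rightarrow> nat \<Rightarrow> nat" where
  "next_stop U j = Suc j mod length (r_stops U)"

definition v_after :: "'v route \<Rightarrow> pos \<Rightarrow> pos" where
  "v_after U y = (if snd y = 0 then y else (Suc (fst y) mod length (r_walk U), 0))"

definition v_before :: "'v route \<Rightarrow> pos \<Rightarrow> pos" where
  "v_before U y = (fst y, 0)"

definition detour_len :: "'v route \<Rightarrow> 'v point \<Rightarrow> nat \<Rightarrow> real" where
  "detour_len U x j =
     (let s = stop U j; s' = stop U (next_stop U j); va = v_after U s; vb = v_before U s'
      in l (pt U s) (pt U va) + l (pt U va) x + l x (pt U vb) + l (pt U vb) (pt U s') + arc U s' s)"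

definition is_last_stop :: "'v route \<Rightarrow> 'v point \<Rightarrow> nat \<Rightarrow> bool" where
  "is_last_stop U x j \<longleftrightarrow> j < length (r_stops U) \<and>
     (\<forall>i<length (r_stops U). detour_len U x j \<le> detour_len U x i)"

end

section \<open>Refueling sets and their endpoints\<close>

text \<open>\<open>last_stop\<close> breaks the ties in the choice of the last stop.\<close>

locale dedicated_routes = metric_network V E len P
  for V :: "'v set" and E :: "'v set set" and len :: "'v set \<Rightarrow> real"
    and P :: "'v point \<Rightarrow> 'v point \<Rightarrow> 'v point list" +
  fixes R :: real
    and D :: real
    and H :: "'v route set"
    and last_stop :: "'v route \<Rightarrow> 'v point \<Rightarrow> nat"
  assumes R_pos: "R > 0"
    and D_nonneg: "D \<ge> 0"
    and finite_H: "finite H"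
    and H_nonempty: "H \<noteq> {}"
    and routes: "\<And>U. U \<in> H \<Longrightarrow> is_route R U"
    and last_stop: "\<And>U x. U \<in> H \<Longrightarrow> x \<in> points \<Longrightarrow> is_last_stop U x (last_stop U x)"
begin

definition start_pos :: "'v route \<Rightarrow> 'v point \<Rightarrow> pos" where
  "start_pos U x = v_after U (stop U (last_stop U x))"

definition vbar_pos :: "'v route \<Rightarrow> 'v point \<Rightarrow> pos" where
  "vbar_pos U x = v_before U (stop U (next_stop U (last_stop U x)))"

definition vbar :: "'v route \<Rightarrow> 'v point \<Rightarrow> 'v point" where
  "vbar U x = pt U (vbar_pos U x)"

definition vdev :: "'v route \<Rightarrow> 'v point \<Rightarrow> 'v point" where
  "vdev U x = last (takeWhile (\<lambda>p. p \<in> vpt ` arc_vertices U (start_pos U x) (vbar_pos U x))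
                              (P (pt U (start_pos U x)) x))"

text \<open>
  If the walk visits the deviation vertex several times, the visit meant is the first one on the
  sub-route on which the vehicle deviates.
\<close>

definition vdev_pos :: "'v route \<Rightarrow> 'v point \<Rightarrow> pos" where
  "vdev_pos U x = (ARG_MIN (\<lambda>m. arc U (start_pos U x) (m, 0)) m.
                     m < length (r_walk U) \<and> vpt (rv U m) = vdev U x, 0)"

definition rest_len :: "'v route \<Rightarrow> 'v point \<Rightarrow> real" where
  "rest_len U x = (if vbar U x = vdev U x then route_len U else arc U (vbar_pos U x) (vdev_pos U x))"

definition beta :: "'v route \<Rightarrow> 'v \<Rightarrow> 'v \<Rightarrow> real" where
  "beta U q w =
     (let x = vpt q in
      if R - (l (vdev U x) x + l (vpt w) (vbar U x) + rest_len U x) \<ge> l x (vpt w)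
      then l x (vpt w)
      else (R - (l (vdev U x) x + l x (vbar U x) + rest_len U x)) / 2)"

definition delta :: "'v route \<Rightarrow> 'v \<Rightarrow> 'v \<Rightarrow> real" where
  "delta U q w = min (D - l (vdev U (vpt q)) (vpt q)) (beta U q w)"

definition RS_from :: "'v route \<Rightarrow> 'v \<Rightarrow> 'v \<Rightarrow> 'v point set" where
  "RS_from U q w = {x \<in> C q w. l (vpt q) x \<le> delta U q w}"

definition RS :: "'v route \<Rightarrow> 'v \<Rightarrow> 'v \<Rightarrow> 'v point set" where
  "RS U a b = (if traverses U a b then C a b else RS_from U a b \<union> RS_from U b a)"

text \<open>
  The connected components of a refueling set are closed sub-segments of the edge, possibly single
  points (s = t). Both orientations of an edge give the same refueling set and endpoints; \<open>EP\<close> is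
  the set of points output after all routes and edges have been scanned.
\<close>

definition EP_route_edge :: "'v route \<Rightarrow> 'v \<Rightarrow> 'v \<Rightarrow> 'v point set" where
  "EP_route_edge U a b =
     \<Union>{{loc a b s, loc a b t} |s t. 0 \<le> s \<and> s \<le> t \<and> t \<le> len {a, b} \<and>
          loc a b ` {s..t} \<in> components (RS U a b)}"

definition EP_edge :: "'v \<Rightarrow> 'v \<Rightarrow> 'v point set" where
  "EP_edge a b = (\<Union>U\<in>H. EP_route_edge U a b)"

definition EP :: "'v point set" where
  "EP = (\<Union>(a, b)\<in>{(a, b). {a, b} \<in> E}. EP_edge a b)"

end

end

theory Submission
  imports Defs
begin

text \<open>
  It suffices that one route contributes at most four endpoints to one edge; the bound then follows
  by summing over routes and edges. On an edge the distance function is the length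
  coordinate (\<open>l_loc\<close>), because the chosen shortest path stays on the edge. Each of the two
  sets \<open>RS_from\<close> is therefore a closed segment attached to one end of the edge, so a refueling set
  is always the image of a union of two closed intervals (\<open>RS_two_segments\<close>). Whenever a component
  meets one of the two segments it contains that segment entirely, so a component can begin and
  end only where one of the segments does (\<open>segment_component_ends\<close>). This leaves the four ends
  of the two segments.

  Edges are unordered while endpoints are computed for an ordered pair of vertices.
  Reversing the orientation does not change the result (\<open>EP_route_edge_commute\<close>), so each edge
  is counted only once.
\<close>

text \<open>
  A component beginning at a point of one of the two intervals contains the whole interval, hence
  it begins no later than the interval does; it cannot begin earlier, as its first point lies in
  that interval. The same argument applies at the other end.
\<close>

lemma segment_component_ends:
  fixes f :: "real \<Rightarrow> 'a::topological_space"
  assumes cont: "continuous_on ({p..q} \<union> {r..u}) f"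
    and inj: "inj_on f ({p..q} \<union> {r..u} \<union> {s..t})"
    and st: "s \<le> t"
    and comp: "f ` {s..t} \<in> components (f ` ({p..q} \<union> {r..u}))"
  shows "{s, t} \<subseteq> {p, q, r, u}"
proof -
  have "f ` {s..t} \<subseteq> f ` ({p..q} \<union> {r..u})"
    using comp by (rule in_components_subset)
  then have sub: "{s..t} \<subseteq> {p..q} \<union> {r..u}"
    using inj_on_image_subset_iff[OF inj, of "{s..t}" "{p..q} \<union> {r..u}"] by blast
  have absorb: "{c..d} \<subseteq> {s..t}"
    if cd: "{c..d} \<subseteq> {p..q} \<union> {r..u}" and y: "y \<in> {c..d}" "y \<in> {s..t}" for c d y
  proof -
    have "connected (f ` {c..d})"
      using continuous_on_subset[OF cont cd] by (intro connected_continuous_image) auto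
    moreover have "f ` {s..t} \<inter> f ` {c..d} \<noteq> {}" using y by blast
    ultimately have "f ` {c..d} \<subseteq> f ` {s..t}"
      using cd by (intro components_maximal[OF comp] image_mono) auto
    then show ?thesis
      using inj_on_image_subset_iff[OF inj, of "{c..d}" "{s..t}"] cd by blast
  qed
  have ends: "(y = s \<longrightarrow> s = c) \<and> (y = t \<longrightarrow> t = d)"
    if cd: "{c..d} \<subseteq> {p..q} \<union> {r..u}" and y: "y \<in> {c..d}" "y \<in> {s..t}" for c d y
  proof -
    have "c \<le> d" using y by auto
    then have "s \<le> c" "d \<le> t" using absorb[OF cd y] by auto
    then show ?thesis using y by auto
  qed
  have "s = p \<or> s = r" "t = q \<or> t = u"
    using ends[of p q s] ends[of r u s] ends[of p q t] ends[of r u t] sub st by auto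
  then show ?thesis by auto
qed

context network
begin

lemma edge_ends_distinct: "{a, b} \<in> E \<Longrightarrow> a \<noteq> b"
  using simple by (fastforce simp: doubleton_eq_iff)

lemma finite_E: "finite E"
proof (rule finite_subset)
  show "E \<subseteq> Pow V" using simple by auto
qed (simp add: finite_V)

lemma loc_0: "loc a b 0 = vpt a"
  by (auto simp: loc_def vpt_def)

lemma loc_reverse:
  assumes "{a, b} \<in> E"
  shows "loc b a t = loc a b (len {a, b} - t)"
  using edge_ends_distinct[OF assms] len_pos[OF assms]
  by (auto simp: loc_def fun_eq_iff insert_commute field_simps)

lemma loc_reverse_image:
  assumes "{a, b} \<in> E"
  shows "loc b a ` {s..t} = loc a b ` {len {a, b} - t..len {a, b} - s}"
proof -
  have "loc b a ` {s..t} = loc a b ` (\<lambda>x. len {a, b} - x) ` {s..t}"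
    unfolding image_image by (intro image_cong refl loc_reverse[OF assms])
  then show ?thesis by simp
qed

lemma C_commute: "{a, b} \<in> E \<Longrightarrow> C b a = C a b"
  using loc_reverse_image[of a b 0 "len {a, b}"] by (simp add: C_def insert_commute)

lemma inj_loc:
  assumes "{a, b} \<in> E"
  shows "inj_on (loc a b) S"
proof (rule inj_onI)
  fix s t assume "loc a b s = loc a b t"
  then have "loc a b s b = loc a b t b" by simp
  then show "s = t"
    using edge_ends_distinct[OF assms] len_pos[OF assms] by (simp add: loc_def)
qed

lemma continuous_on_loc:
  assumes "{a, b} \<in> E"
  shows "continuous_on S (loc a b)"
proof (rule continuous_on_coordinatewise_then_product)
  fix v
  show "continuous_on S (\<lambda>t. loc a b t v)"
    using len_pos[OF assms]
    by (cases "v = a"; cases "v = b") (auto simp: loc_def intro!: continuous_intros)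
qed

lemma loc_in_points:
  "{a, b} \<in> E \<Longrightarrow> t \<in> {0..len {a, b}} \<Longrightarrow> loc a b t \<in> points"
  unfolding points_def C_def by blast

text \<open>
  Each step of a path on an edge has the length of the coordinate interval between its two ends,
  also if those ends happen to lie on a second edge, so the triangle inequality for real numbers
  applies.
\<close>

lemma path_len_on_edge_ge:
  assumes e: "{a, b} \<in> E" and t: "t \<in> {0..len {a, b}}"
  shows "ps \<noteq> [] \<Longrightarrow> set ps \<subseteq> C a b \<Longrightarrow> s \<in> {0..len {a, b}} \<Longrightarrow> hd ps = loc a b s \<Longrightarrow>
    last ps = loc a b t \<Longrightarrow> \<bar>s - t\<bar> \<le> path_len ps"
proof (induction ps arbitrary: s)
  case (Cons p ps)
  show ?case
  proof (cases ps)
    case Nil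
    then have "s = t" using Cons.prems inj_loc[OF e, of UNIV] by (auto dest: injD)
    then show ?thesis using Nil by (simp add: path_len_def)
  next
    case (Cons p' qs)
    then obtain s' where s': "s' \<in> {0..len {a, b}}" "p' = loc a b s'"
      using Cons.prems by (auto simp: C_def)
    have "\<bar>s' - t\<bar> \<le> path_len ps"
      by (rule Cons.IH) (use Cons Cons.prems s' in auto)
    moreover have "path_len (p # ps) = \<bar>s - s'\<bar> + path_len ps"
      using Cons.prems s' step_len_loc[OF e Cons.prems(3) s'(1)]
      by (simp add: path_len_def Cons)
    ultimately show ?thesis by simp
  qed
qed simp

end

context metric_network
begin

text \<open>
  The path with the two points as its only entries is a competitor for the shortest path, which
  gives the upper bound; the lower bound holds since the selected shortest path stays on the edge.
\<close>

lemma l_loc: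
  assumes e: "{a, b} \<in> E" and s: "s \<in> {0..len {a, b}}" and t: "t \<in> {0..len {a, b}}"
  shows "l (loc a b s) (loc a b t) = \<bar>s - t\<bar>"
proof -
  let ?x = "loc a b s" and ?y = "loc a b t"
  have in_C: "?x \<in> C a b" "?y \<in> C a b" using s t by (auto simp: C_def)
  have points: "?x \<in> points" "?y \<in> points" using e s t by (auto intro: loc_in_points)
  have shortest: "is_shortest_path ?x ?y (P ?x ?y)" using points by (rule P_shortest)
  have "l ?x ?y \<le> \<bar>s - t\<bar>"
  proof (cases "s = t")
    case True
    then have "is_path ?x ?y [?x]" using points by (simp add: is_path_def)
    then have "l ?x ?y \<le> path_len [?x]" using shortest by (simp add: is_shortest_path_def l_def)
    then show ?thesis by (simp add: path_len_def)
  next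
    case False
    then have "?x \<noteq> ?y" using inj_loc[OF e, of UNIV] by (auto dest: injD)
    then have "is_path ?x ?y [?x, ?y]"
      using points in_C e by (auto simp: is_path_def step_def)
    then have "l ?x ?y \<le> path_len [?x, ?y]"
      using shortest by (simp add: is_shortest_path_def l_def)
    then show ?thesis by (simp add: path_len_def step_len_loc[OF e s t])
  qed
  moreover have "\<bar>s - t\<bar> \<le> l ?x ?y"
    unfolding l_def
    by (rule path_len_on_edge_ge[OF e t _ triangle[OF e in_C] s])
      (use shortest in \<open>auto simp: is_shortest_path_def is_path_def\<close>)
  ultimately show ?thesis by simp
qed

end

context dedicated_routes
begin

lemma RS_from_segment:
  assumes e: "{q, w} \<in> E"
  shows "RS_from U q w = loc q w ` {0..min (len {q, w}) (delta U q w)}"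
proof -
  have "l (vpt q) (loc q w t) = t" if "t \<in> {0..len {q, w}}" for t
    using l_loc[OF e _ that, of 0] that by (simp add: loc_0)
  then show ?thesis by (auto simp: RS_from_def C_def)
qed

text \<open>
  A traversed edge also has this form, as the union of the whole edge with itself. Otherwise the
  second segment, measured from the end b, is expressed in the coordinate that starts at a; either
  segment may be empty.
\<close>

lemma RS_two_segments:
  assumes e: "{a, b} \<in> E"
  obtains p q r u where "RS U a b = loc a b ` ({p..q} \<union> {r..u})"
proof (cases "traverses U a b")
  case True
  then have "RS U a b = loc a b ` ({0..len {a, b}} \<union> {0..len {a, b}})"
    by (simp add: RS_def C_def)
  then show ?thesis by (rule that)
next
  case False
  have e': "{b, a} \<in> E" using e by (simp add: insert_commute)
  show ?thesis
    by (rule that)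
      (use False in \<open>simp add: RS_def RS_from_segment[OF e] RS_from_segment[OF e']
        loc_reverse_image[OF e] image_Un\<close>)
qed

lemma EP_route_edge_bound:
  assumes e: "{a, b} \<in> E"
  shows "finite (EP_route_edge U a b) \<and> card (EP_route_edge U a b) \<le> 4"
proof -
  obtain p q r u where RS: "RS U a b = loc a b ` ({p..q} \<union> {r..u})"
    using RS_two_segments[OF e] .
  let ?ends = "loc a b ` set [p, q, r, u]"
  have "{loc a b s, loc a b t} \<subseteq> ?ends"
    if "s \<le> t" "loc a b ` {s..t} \<in> components (RS U a b)" for s t
    using segment_component_ends[OF continuous_on_loc[OF e] inj_loc[OF e] that[unfolded RS]]
    by auto
  then have sub: "EP_route_edge U a b \<subseteq> ?ends"
    unfolding EP_route_edge_def by blast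
  have "card ?ends \<le> card (set [p, q, r, u])" by (rule card_image_le) simp
  also have "\<dots> \<le> length [p, q, r, u]" by (rule card_length)
  finally have "card ?ends \<le> 4" by simp
  moreover have "card (EP_route_edge U a b) \<le> card ?ends" using sub by (intro card_mono) auto
  ultimately show ?thesis using finite_subset[OF sub] by auto
qed

lemma RS_commute: "{a, b} \<in> E \<Longrightarrow> RS U b a = RS U a b"
  by (auto simp: RS_def traverses_def C_commute insert_commute)

lemma EP_route_edge_commute_subset:
  assumes e: "{a, b} \<in> E"
  shows "EP_route_edge U b a \<subseteq> EP_route_edge U a b"
proof
  fix x assume "x \<in> EP_route_edge U b a"
  then obtain s t where st: "0 \<le> s" "s \<le> t" "t \<le> len {a, b}"
    and comp: "loc b a ` {s..t} \<in> components (RS U b a)"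
    and x: "x \<in> {loc b a s, loc b a t}"
    unfolding EP_route_edge_def by (auto simp: insert_commute)
  let ?s = "len {a, b} - t" and ?t = "len {a, b} - s"
  have "loc a b ` {?s..?t} \<in> components (RS U a b)"
    using comp by (simp add: loc_reverse_image[OF e] RS_commute[OF e])
  moreover have "0 \<le> ?s" "?s \<le> ?t" "?t \<le> len {a, b}" using st by auto
  moreover have "x \<in> {loc a b ?s, loc a b ?t}" using x by (auto simp: loc_reverse[OF e])
  ultimately show "x \<in> EP_route_edge U a b"
    unfolding EP_route_edge_def by blast
qed

lemma EP_route_edge_commute:
  assumes e: "{a, b} \<in> E"
  shows "EP_route_edge U b a = EP_route_edge U a b"
  using EP_route_edge_commute_subset[OF e] EP_route_edge_commute_subset[of b a] e
  by (auto simp: insert_commute)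

lemma EP_bound: "finite EP \<and> card EP \<le> 4 * card H * card E"
proof -
  \<comment> \<open>The endpoints of an unordered edge are collected over both its orientations, which avoids
    choosing one of them.\<close>
  define F where "F e U = \<Union>{EP_route_edge U a b |a b. {a, b} = e}" for e U
  have F: "finite (F e U) \<and> card (F e U) \<le> 4" if edge: "e \<in> E" for e U
  proof -
    obtain a b where e: "e = {a, b}" using simple[OF edge] by auto
    have "F e U = EP_route_edge U a b"
      using EP_route_edge_commute[of a b U] edge by (auto simp: F_def e doubleton_eq_iff)
    then show ?thesis using EP_route_edge_bound[of a b U] edge by (simp add: e)
  qed
  have EP: "EP = (\<Union>e\<in>E. \<Union>U\<in>H. F e U)"
    unfolding EP_def EP_edge_def F_def by blast
  have "card EP \<le> (\<Sum>e\<in>E. card (\<Union>U\<in>H. F e U))"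
    unfolding EP by (rule card_UN_le[OF finite_E])
  also have "\<dots> \<le> (\<Sum>e\<in>E. \<Sum>U\<in>H. card (F e U))"
    by (intro sum_mono card_UN_le finite_H)
  also have "\<dots> \<le> (\<Sum>e\<in>E. \<Sum>U\<in>H. 4)"
    using F by (intro sum_mono) auto
  finally have "card EP \<le> 4 * card H * card E" by (simp add: mult_ac)
  moreover have "finite EP"
    unfolding EP using F finite_E finite_H by auto
  ultimately show ?thesis by simp
qed

end

theorem theorem2:
  fixes V :: "'v set" and E :: "'v set set" and len :: "'v set \<Rightarrow> real"
    and P :: "'v point \<Rightarrow> 'v point \<Rightarrow> 'v point list"
    and R D :: real and H :: "'v route set"
    and last_stop :: "'v route \<Rightarrow> 'v point \<Rightarrow> nat"
  assumes "dedicated_routes V E len P R D H last_stop"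
  shows "finite (dedicated_routes.EP E len P R D H last_stop) \<and>
         card (dedicated_routes.EP E len P R D H last_stop) \<le> 4 * card H * card E"
  using assms by (rule dedicated_routes.EP_bound)

end
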